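(* Let $K$ be a field of characteristic zero and let $A$ be a commutative unital $K$-algebra which is a complete $\lambda$-ring with Adams operations $\psi^n$ satisfying $\psi^n|_K=\mathrm{id}$, and with decreasing filtration $A=F^0A\supset A^+=F^1A\supset F^2A\supset\cdots$. Let $Z:\mathsf{QS}(A^+)\to A$ be the $K$-linear map with $Z(1_K)=1$ and $$Z(a_1\otimes\dots\otimes a_l)=\sum_{n_1>\dots>n_l>0}\prod_{i=1}^l\psi^{n_i}(a_i),\qquad l\ge1,\ a_1,\dots,a_l\in A^+.$$ Then $Z$ is an algebra morphism. Moreover, for all $a_1,\dots,a_l\in A^+$, $$Z(a_1\otimes\dots\otimes a_l)=\mathcal P_{a_1}\mathcal T\cdots\mathcal P_{a_l}\mathcal T(1)\big|_{t=1},$$ where for $a\in A$, $\mathcal P_a:tA[[t]]\to tA[[t]]$ and $\mathcal T:A[[t]]\to tA[[t]]$ are the continuous $A$-linear operators given by $\mathcal P_a(t^n)=\psi^n(a)t^n$ and $\mathcal T(f)=\frac t{1-t}f$.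
   Context: Since $A$ is a $\mathbb Q$-algebra, the $\lambda$-ring structure amounts to its Adams operations: ring endomorphisms $\psi^n:A\to A$ ($n\ge1$) with $\psi^1=\mathrm{id}$ and $\psi^m\psi^n=\psi^{mn}$. Complete $\lambda$-ring means: the filtration $(F^iA)_{i\ge0}$ satisfies $F^iA\cdot F^jA\subset F^{i+j}A$ and $\psi^n(F^iA)\subset F^{ni}A$, and $A$ is complete (and separated) for the filtration topology, i.e. $A\cong\varprojlim_i A/F^iA$; the $F^iA$ are $K$-subspaces. Infinite sums, and evaluation at $t=1$, are understood with respect to this topology. For a (possibly non-unital) commutative $K$-algebra $C$, the quasi-shuffle algebra is $\mathsf{QS}(C)=\bigoplus_{k\ge0}C^{\otimes k}$ (tensors over $K$, $C^{\otimes0}=K$) with the bilinear product $*$ defined inductively by $1_K*u=u*1_K=u$ and $$(au)*(bv)=a(u*bv)+b(au*v)+(ab)(u*v),\qquad a,b\in C,\ u,v\in\mathsf{QS}(C),$$ where $au=a\otimes u$. Here it is applied to $C=A^+$. Continuity of the operators is with respect to the $t$-adic topology, i.e. $\mathcal P_a(\sum_{n\ge 1} c_nt^n)=\sum_{n\ge 1} c_n\psi^n(a)t^n$. *)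

theory Defs
  imports
    "HOL-Analysis.Analysis"
    "HOL-Library.Poly_Mapping"
    "HOL-Computational_Algebra.Formal_Power_Series"
begin

section \<open>Formal linear combinations of words\<close>

text \<open>The free vector space on all words is \<^typ>\<open>'a list \<Rightarrow>\<^sub>0 'k\<close>.\<close>

definition word_scale :: "'k::field \<Rightarrow> ('a list \<Rightarrow>\<^sub>0 'k) \<Rightarrow> ('a list \<Rightarrow>\<^sub>0 'k)" where
  "word_scale c p = Poly_Mapping.map ((*) c) p"

lemma lookup_word_scale [simp]: "Poly_Mapping.lookup (word_scale c p) w = c * Poly_Mapping.lookup p w"
  unfolding word_scale_def by transfer (auto simp: when_def)

lemma word_scale_single [simp]: "word_scale c (Poly_Mapping.single w d) = Poly_Mapping.single w (c * d)"
  by (simp add: word_scale_def)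

interpretation words: vector_space word_scale
  by standard (auto intro!: poly_mapping_eqI simp: lookup_add algebra_simps)

definition lin_ext :: "('a list \<Rightarrow> ('b list \<Rightarrow>\<^sub>0 'k)) \<Rightarrow> ('a list \<Rightarrow>\<^sub>0 'k::field) \<Rightarrow> ('b list \<Rightarrow>\<^sub>0 'k)" where
  "lin_ext f p = (\<Sum>w\<in>Poly_Mapping.keys p. word_scale (Poly_Mapping.lookup p w) (f w))"

definition prepend :: "'a \<Rightarrow> ('a list \<Rightarrow>\<^sub>0 'k::field) \<Rightarrow> ('a list \<Rightarrow>\<^sub>0 'k)" where
  "prepend a = lin_ext (\<lambda>w. Poly_Mapping.single (a # w) 1)"

fun qsh_words :: "'a::comm_ring list \<Rightarrow> 'a list \<Rightarrow> ('a list \<Rightarrow>\<^sub>0 'k::field)" where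
  "qsh_words [] v = Poly_Mapping.single v 1"
| "qsh_words (a # u) [] = Poly_Mapping.single (a # u) 1"
| "qsh_words (a # u) (b # v) =
     prepend a (qsh_words u (b # v)) + prepend b (qsh_words (a # u) v)
       + prepend (a * b) (qsh_words u v)"

definition qsh :: "('a::comm_ring list \<Rightarrow>\<^sub>0 'k::field) \<Rightarrow> ('a list \<Rightarrow>\<^sub>0 'k) \<Rightarrow> ('a list \<Rightarrow>\<^sub>0 'k)" where
  "qsh p q = lin_ext (\<lambda>u. lin_ext (\<lambda>v. qsh_words u v) q) p"

section \<open>The quasi-shuffle algebra\<close>

text \<open>
  Below, \<open>C\<close> is a (possibly non-unital) subalgebra of a commutative \<open>K\<close>-algebra of type
  \<^typ>\<open>'a\<close> whose scalar multiplication is \<open>smul\<close>. The direct sum over \<open>k \<ge> 0\<close> of the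
  \<open>k\<close>-fold tensor powers of \<open>C\<close> over \<open>K\<close> is constructed as the free \<open>K\<close>-vector space on
  words over \<open>C\<close> modulo multilinearity in each letter. As the defining relations only
  involve words of one and the same length \<open>k\<close>, this quotient is the direct sum of the usual
  constructions of the tensor powers. Its elements are represented by cosets.
\<close>

definition free_words :: "'a set \<Rightarrow> ('a list \<Rightarrow>\<^sub>0 'k::field) set" where
  "free_words C = {p. \<forall>w\<in>Poly_Mapping.keys p. set w \<subseteq> C}"

definition multilinearity_relations ::
    "('k::field \<Rightarrow> 'a::comm_ring \<Rightarrow> 'a) \<Rightarrow> 'a set \<Rightarrow> ('a list \<Rightarrow>\<^sub>0 'k) set" where
  "multilinearity_relations smul C =
     {Poly_Mapping.single (u @ (a + b) # v) 1 - Poly_Mapping.single (u @ a # v) 1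
        - Poly_Mapping.single (u @ b # v) 1
       | u a b v. set u \<subseteq> C \<and> a \<in> C \<and> b \<in> C \<and> set v \<subseteq> C} \<union>
     {Poly_Mapping.single (u @ smul c a # v) 1 - Poly_Mapping.single (u @ a # v) c
       | u c a v. set u \<subseteq> C \<and> a \<in> C \<and> set v \<subseteq> C}"

definition tensor_null ::
    "('k::field \<Rightarrow> 'a::comm_ring \<Rightarrow> 'a) \<Rightarrow> 'a set \<Rightarrow> ('a list \<Rightarrow>\<^sub>0 'k) set" where
  "tensor_null smul C = words.span (multilinearity_relations smul C)"

definition tensor_class ::
    "('k::field \<Rightarrow> 'a::comm_ring \<Rightarrow> 'a) \<Rightarrow> 'a set \<Rightarrow> ('a list \<Rightarrow>\<^sub>0 'k) \<Rightarrow> ('a list \<Rightarrow>\<^sub>0 'k) set" where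
  "tensor_class smul C p = {q. q - p \<in> tensor_null smul C}"

definition QS ::
    "('k::field \<Rightarrow> 'a::comm_ring \<Rightarrow> 'a) \<Rightarrow> 'a set \<Rightarrow> ('a list \<Rightarrow>\<^sub>0 'k) set set" where
  "QS smul C = tensor_class smul C ` free_words C"

definition pure_tensor ::
    "('k::field \<Rightarrow> 'a::comm_ring \<Rightarrow> 'a) \<Rightarrow> 'a set \<Rightarrow> 'a list \<Rightarrow> ('a list \<Rightarrow>\<^sub>0 'k) set" where
  "pure_tensor smul C as = tensor_class smul C (Poly_Mapping.single as 1)"

text \<open>
  The operations on cosets are induced by those on representatives. Independence of the
  representatives is proved in \<open>qs_add_class\<close>, \<open>qs_scale_class\<close> and \<open>qs_mult_class\<close> below.
\<close>

definition qs_one ::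
    "('k::field \<Rightarrow> 'a::comm_ring \<Rightarrow> 'a) \<Rightarrow> 'a set \<Rightarrow> ('a list \<Rightarrow>\<^sub>0 'k) set" where
  "qs_one smul C = pure_tensor smul C []"

definition qs_add where
  "qs_add smul C X Y = (\<Union>p\<in>X. \<Union>q\<in>Y. tensor_class smul C (p + q))"

definition qs_scale where
  "qs_scale smul C c X = (\<Union>p\<in>X. tensor_class smul C (word_scale c p))"

definition qs_mult where
  "qs_mult smul C X Y = (\<Union>p\<in>X. \<Union>q\<in>Y. tensor_class smul C (qsh p q))"

definition qs_linear ::
    "('k::field \<Rightarrow> 'a::comm_ring_1 \<Rightarrow> 'a) \<Rightarrow> 'a set \<Rightarrow> (('a list \<Rightarrow>\<^sub>0 'k) set \<Rightarrow> 'a) \<Rightarrow> bool" where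
  "qs_linear smul C Z \<longleftrightarrow>
     (\<forall>X\<in>QS smul C. \<forall>Y\<in>QS smul C. Z (qs_add smul C X Y) = Z X + Z Y) \<and>
     (\<forall>c. \<forall>X\<in>QS smul C. Z (qs_scale smul C c X) = smul c (Z X))"

definition qs_algebra_morphism ::
    "('k::field \<Rightarrow> 'a::comm_ring_1 \<Rightarrow> 'a) \<Rightarrow> 'a set \<Rightarrow> (('a list \<Rightarrow>\<^sub>0 'k) set \<Rightarrow> 'a) \<Rightarrow> bool" where
  "qs_algebra_morphism smul C Z \<longleftrightarrow>
     qs_linear smul C Z \<and> Z (qs_one smul C) = 1 \<and>
     (\<forall>X\<in>QS smul C. \<forall>Y\<in>QS smul C. Z (qs_mult smul C X Y) = Z X * Z Y)"

subsection \<open>The operations are well defined\<close>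

lemma lin_ext_superset:
  assumes "finite S" "Poly_Mapping.keys p \<subseteq> S"
  shows "lin_ext f p = (\<Sum>w\<in>S. word_scale (Poly_Mapping.lookup p w) (f w))"
  unfolding lin_ext_def using assms
  by (intro sum.mono_neutral_left) (auto simp: in_keys_iff)

lemma lin_ext_add: "lin_ext f (p + q) = lin_ext f p + lin_ext f q"
proof -
  let ?S = "Poly_Mapping.keys p \<union> Poly_Mapping.keys q"
  have "lin_ext f (p + q) = (\<Sum>w\<in>?S. word_scale (Poly_Mapping.lookup (p + q) w) (f w))"
    by (intro lin_ext_superset Poly_Mapping.keys_add) auto
  also have "\<dots> = lin_ext f p + lin_ext f q"
    by (subst (1 2) lin_ext_superset[of ?S])
       (auto simp: lookup_add words.scale_left_distrib sum.distrib)
  finally show ?thesis .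
qed

lemma lin_ext_scale: "lin_ext f (word_scale c p) = word_scale c (lin_ext f p)"
  by (subst (1 2) lin_ext_superset[of "Poly_Mapping.keys p"])
     (auto simp: in_keys_iff words.scale_sum_right)

lemma lin_ext_zero [simp]: "lin_ext f 0 = 0"
  by (simp add: lin_ext_def)

lemma lin_ext_single [simp]: "lin_ext f (Poly_Mapping.single w c) = word_scale c (f w)"
  by (subst lin_ext_superset[of "{w}"]) auto

lemma lin_ext_diff: "lin_ext f (p - q) = lin_ext f p - lin_ext f q"
  by (metis add_diff_cancel_right' diff_add_cancel lin_ext_add)

lemma lin_ext_fun_diff: "lin_ext (\<lambda>w. f w - g w) p = lin_ext f p - lin_ext g p"
  by (simp add: lin_ext_def words.scale_right_diff_distrib sum_subtractf)

lemma lin_ext_fun_scale: "lin_ext (\<lambda>w. word_scale c (f w)) p = word_scale c (lin_ext f p)"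
  by (simp add: lin_ext_def words.scale_sum_right mult.commute)

lemmas prepend_add = lin_ext_add[where f = "\<lambda>w. Poly_Mapping.single (a # w) 1" for a, folded prepend_def]
lemmas prepend_diff = lin_ext_diff[where f = "\<lambda>w. Poly_Mapping.single (a # w) 1" for a, folded prepend_def]
lemmas prepend_scale = lin_ext_scale[where f = "\<lambda>w. Poly_Mapping.single (a # w) 1" for a, folded prepend_def]

lemma prepend_single [simp]: "prepend a (Poly_Mapping.single w c) = Poly_Mapping.single (a # w) c"
  by (simp add: prepend_def)

lemma subspace_free_words: "words.subspace (free_words C :: ('a list \<Rightarrow>\<^sub>0 'b::field) set)"
proof (rule words.subspaceI)
  fix p q :: "'a list \<Rightarrow>\<^sub>0 'b"
  assume "p \<in> free_words C" "q \<in> free_words C"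
  then show "p + q \<in> free_words C"
    unfolding free_words_def using Poly_Mapping.keys_add[of p q] by blast
qed (auto simp: free_words_def in_keys_iff)

lemma single_in_free_words: "set w \<subseteq> C \<Longrightarrow> Poly_Mapping.single w c \<in> free_words C"
  by (auto simp: free_words_def)

lemma lin_ext_mem:
  assumes "words.subspace S" "\<And>w. set w \<subseteq> C \<Longrightarrow> f w \<in> S" "p \<in> free_words C"
  shows "lin_ext f p \<in> S"
  unfolding lin_ext_def using assms
  by (intro words.subspace_sum words.subspace_scale) (auto simp: free_words_def)

lemma qsh_words_free:
  assumes "\<And>a b. a \<in> C \<Longrightarrow> b \<in> C \<Longrightarrow> a * b \<in> C" "set u \<subseteq> C" "set v \<subseteq> C"
  shows "qsh_words u v \<in> free_words C"
  using assms(2,3)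
proof (induction u v rule: qsh_words.induct)
  case (3 a u b v)
  have pre: "prepend x p \<in> free_words C" if "x \<in> C" "p \<in> free_words C"
    for x and p :: "'a list \<Rightarrow>\<^sub>0 'b"
    unfolding prepend_def using that
    by (intro lin_ext_mem[OF subspace_free_words] single_in_free_words) auto
  show ?case
    using 3 assms(1) by (auto intro!: words.subspace_add[OF subspace_free_words] pre)
qed (auto simp: free_words_def)

lemma qsh_words_commute: "qsh_words u v = qsh_words v u"
proof (induction u v rule: qsh_words.induct)
  case (1 v)
  then show ?case by (cases v) auto
qed (auto simp: mult.commute add_ac)

lemma qsh_commute: "qsh p q = qsh q p"
  unfolding qsh_def lin_ext_def words.scale_sum_right
  by (subst sum.swap) (simp add: qsh_words_commute mult.commute)

context
  fixes smul :: "'k::field \<Rightarrow> 'a::comm_ring \<Rightarrow> 'a" and C :: "'a set"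
  assumes vs: "vector_space smul"
    and scale_mult: "\<And>c x y. smul c (x * y) = smul c x * y"
    and sub: "module.subspace smul C"
    and mult_closed: "\<And>a b. a \<in> C \<Longrightarrow> b \<in> C \<Longrightarrow> a * b \<in> C"
begin

interpretation vs: vector_space smul by (fact vs)

private abbreviation "N \<equiv> tensor_null smul C"

private lemma N_sub: "words.subspace N"
  by (simp add: tensor_null_def)

private lemma N_add: 
  assumes "set u \<subseteq> C" "a \<in> C" "b \<in> C" "set v \<subseteq> C"
  shows "Poly_Mapping.single (u @ (a + b) # v) 1 - Poly_Mapping.single (u @ a # v) 1
        - Poly_Mapping.single (u @ b # v) 1 \<in> N"
  unfolding tensor_null_def multilinearity_relations_def
  using assms by (intro words.span_base) blast

private lemma N_scale:
  assumes "set u \<subseteq> C" "a \<in> C" "set v \<subseteq> C"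
  shows "Poly_Mapping.single (u @ smul c a # v) 1 - Poly_Mapping.single (u @ a # v) c \<in> N"
  unfolding tensor_null_def multilinearity_relations_def
  using assms by (intro words.span_base) blast

private lemma lin_ext_null:
  assumes "p \<in> N" "words.subspace S"
    and "\<And>r. r \<in> multilinearity_relations smul C \<Longrightarrow> lin_ext f r \<in> S"
  shows "lin_ext f p \<in> S"
  using assms(1) unfolding tensor_null_def
proof (induction rule: words.span_induct_alt)
  case base
  then show ?case using assms(2) by (simp add: words.subspace_0)
next
  case (step c x y)
  then show ?case
    using assms(2,3) by (simp add: lin_ext_add lin_ext_scale words.subspace_add words.subspace_scale)
qed

private lemma prepend_null:
  assumes "x \<in> C" "p \<in> N"
  shows "prepend x p \<in> N"
  unfolding prepend_def
proof (rule lin_ext_null[OF assms(2) N_sub])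
  fix r assume "r \<in> multilinearity_relations smul C"
  then show "lin_ext (\<lambda>w. Poly_Mapping.single (x # w) 1) r \<in> N"
    unfolding multilinearity_relations_def
    using N_add[of "x # _"] N_scale[of "x # _"] assms(1)
    by (fastforce simp: lin_ext_diff)
qed

private lemma prepend_sum_null:
  assumes "a \<in> C" "b \<in> C" "p \<in> free_words C"
  shows "prepend (a + b) p - prepend a p - prepend b p \<in> N"
  unfolding prepend_def lin_ext_fun_diff[symmetric]
  using N_add[of "[]"] assms by (intro lin_ext_mem[OF N_sub]) auto

private lemma prepend_scale_null:
  assumes "a \<in> C" "p \<in> free_words C"
  shows "prepend (smul c a) p - word_scale c (prepend a p) \<in> N"
  unfolding prepend_def lin_ext_fun_diff[symmetric] lin_ext_fun_scale[symmetric]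
  using N_scale[of "[]"] assms by (intro lin_ext_mem[OF N_sub]) auto

private lemma qsh_words_add_null:
  assumes "set u \<subseteq> C" "a \<in> C" "b \<in> C" "set w \<subseteq> C" "set v \<subseteq> C"
  shows "qsh_words (u @ (a + b) # w) v - qsh_words (u @ a # w) v - qsh_words (u @ b # w) v \<in> N"
  using assms(1,5)
proof (induction "length u + length v" arbitrary: u v rule: less_induct)
  case less
  show ?case
  proof (cases v)
    case Nil
    then show ?thesis
      using N_add[of u a b w] assms less.prems by (subst (1 2 3) qsh_words_commute) simp
  next
    case (Cons y v')
    have y: "y \<in> C" "set v' \<subseteq> C" using less.prems Cons by auto
    define D where "D u v = qsh_words (u @ (a + b) # w) v - qsh_words (u @ a # w) v
        - (qsh_words (u @ b # w) v :: 'a list \<Rightarrow>\<^sub>0 'k)" for u v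
    have IH: "D u v' \<in> N"
      unfolding D_def using less.hyps[of u v'] less.prems Cons by simp
    show ?thesis
    proof (cases u)
      case Nil
      have F: "qsh_words w (y # v') \<in> free_words C" "qsh_words w v' \<in> free_words C"
        using assms y by (auto intro!: qsh_words_free mult_closed)
      let ?P = "\<lambda>a b p. prepend (a + b) p - prepend a p - prepend b p"
      have "D u v = ?P a b (qsh_words w (y # v')) + prepend y (D u v')
          + ?P (a * y) (b * y) (qsh_words w v')"
        by (simp add: D_def Nil Cons prepend_add prepend_diff algebra_simps)
      also have "\<dots> \<in> N"
        using assms y IH F
        by (intro words.subspace_add[OF N_sub] prepend_sum_null prepend_null mult_closed) auto
      finally show ?thesis by (simp add: D_def)
    next
      case (Cons x u')
      have x: "x \<in> C" "set u' \<subseteq> C" using less.prems Cons by auto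
      have IH': "D u' v \<in> N" "D u' v' \<in> N"
        unfolding D_def using less.hyps[of u' v] less.hyps[of u' v'] less.prems x y
          \<open>v = y # v'\<close> Cons by simp_all
      have "D u v = prepend x (D u' v) + prepend y (D u v') + prepend (x * y) (D u' v')"
        by (simp add: D_def Cons \<open>v = y # v'\<close> prepend_add prepend_diff algebra_simps)
      also have "\<dots> \<in> N"
        using x y IH IH'
        by (intro words.subspace_add[OF N_sub] prepend_null mult_closed) auto
      finally show ?thesis by (simp add: D_def)
    qed
  qed
qed

private lemma qsh_words_scale_null:
  assumes "set u \<subseteq> C" "a \<in> C" "set w \<subseteq> C" "set v \<subseteq> C"
  shows "qsh_words (u @ smul c a # w) v - word_scale c (qsh_words (u @ a # w) v) \<in> N"
  using assms(1,4)
proof (induction "length u + length v" arbitrary: u v rule: less_induct)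
  case less
  show ?case
  proof (cases v)
    case Nil
    then show ?thesis
      using N_scale[of u a w c] assms less.prems by (subst (1 2) qsh_words_commute) simp
  next
    case (Cons y v')
    have y: "y \<in> C" "set v' \<subseteq> C" using less.prems Cons by auto
    define D where "D u v = qsh_words (u @ smul c a # w) v
        - word_scale c (qsh_words (u @ a # w) v :: 'a list \<Rightarrow>\<^sub>0 'k)" for u v
    have IH: "D u v' \<in> N"
      unfolding D_def using less.hyps[of u v'] less.prems Cons by simp
    show ?thesis
    proof (cases u)
      case Nil
      have F: "qsh_words w (y # v') \<in> free_words C" "qsh_words w v' \<in> free_words C"
        using assms y by (auto intro!: qsh_words_free mult_closed)
      let ?P = "\<lambda>a p. prepend (smul c a) p - word_scale c (prepend a p)"
      have "D u v = ?P a (qsh_words w (y # v')) + prepend y (D u v')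
          + ?P (a * y) (qsh_words w v')"
        by (simp add: D_def Nil Cons prepend_add prepend_diff prepend_scale scale_mult algebra_simps
              words.scale_right_distrib)
      also have "\<dots> \<in> N"
        using assms y IH F
        by (intro words.subspace_add[OF N_sub] prepend_scale_null prepend_null mult_closed) auto
      finally show ?thesis by (simp add: D_def)
    next
      case (Cons x u')
      have x: "x \<in> C" "set u' \<subseteq> C" using less.prems Cons by auto
      have IH': "D u' v \<in> N" "D u' v' \<in> N"
        unfolding D_def using less.hyps[of u' v] less.hyps[of u' v'] less.prems x y
          \<open>v = y # v'\<close> Cons by simp_all
      have "D u v = prepend x (D u' v) + prepend y (D u v') + prepend (x * y) (D u' v')"
        by (simp add: D_def Cons \<open>v = y # v'\<close> prepend_add prepend_diff prepend_scale algebra_simps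
              words.scale_right_distrib)
      also have "\<dots> \<in> N"
        using x y IH IH'
        by (intro words.subspace_add[OF N_sub] prepend_null mult_closed) auto
      finally show ?thesis by (simp add: D_def)
    qed
  qed
qed

private lemma qsh_null_left:
  assumes "p \<in> N" "q \<in> free_words C"
  shows "qsh p q \<in> N"
  unfolding qsh_def
proof (rule lin_ext_null[OF assms(1) N_sub])
  fix r assume "r \<in> multilinearity_relations smul C"
  then show "lin_ext (\<lambda>u. lin_ext (qsh_words u) q) r \<in> N"
    unfolding multilinearity_relations_def
  proof safe
    fix u a b v assume *: "set u \<subseteq> C" "a \<in> C" "b \<in> C" "set v \<subseteq> C"
    show "lin_ext (\<lambda>u. lin_ext (qsh_words u) q) (Poly_Mapping.single (u @ (a + b) # v) 1
        - Poly_Mapping.single (u @ a # v) 1 - Poly_Mapping.single (u @ b # v) 1) \<in> N"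
      using * assms(2)
      by (simp add: lin_ext_diff lin_ext_fun_diff[symmetric])
         (intro lin_ext_mem[OF N_sub] qsh_words_add_null)
  next
    fix u c a v assume *: "set u \<subseteq> C" "a \<in> C" "set v \<subseteq> C"
    show "lin_ext (\<lambda>u. lin_ext (qsh_words u) q) (Poly_Mapping.single (u @ smul c a # v) 1
        - Poly_Mapping.single (u @ a # v) c) \<in> N"
      using * assms(2)
      by (simp add: lin_ext_diff lin_ext_fun_diff[symmetric] lin_ext_fun_scale[symmetric])
         (intro lin_ext_mem[OF N_sub] qsh_words_scale_null)
  qed
qed

private lemma N_free: "N \<subseteq> free_words C"
  unfolding tensor_null_def
proof (rule words.span_minimal[OF _ subspace_free_words])
  show "multilinearity_relations smul C \<subseteq> free_words C"
    unfolding multilinearity_relations_def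
    using vs.subspace_add[OF sub] vs.subspace_scale[OF sub]
    by (auto intro!: words.subspace_diff[OF subspace_free_words] single_in_free_words)
qed

lemma tensor_class_eq_iff:
  "tensor_class smul C p = tensor_class smul C q \<longleftrightarrow> p - q \<in> tensor_null smul C"
proof
  assume "tensor_class smul C p = tensor_class smul C q"
  moreover have "p \<in> tensor_class smul C p"
    by (simp add: tensor_class_def words.subspace_0[OF N_sub])
  ultimately show "p - q \<in> N" by (simp add: tensor_class_def)
next
  assume *: "p - q \<in> N"
  have "r - p \<in> N \<longleftrightarrow> r - q \<in> N" for r
    using words.subspace_add[OF N_sub _ *, of "r - p"] words.subspace_diff[OF N_sub _ *, of "r - q"]
    by auto
  then show "tensor_class smul C p = tensor_class smul C q"
    by (simp add: tensor_class_def)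
qed

private lemma tensor_class_self: "p \<in> tensor_class smul C p"
  by (simp add: tensor_class_def words.subspace_0[OF N_sub])

lemma qs_add_class:
  "qs_add smul C (tensor_class smul C p) (tensor_class smul C q) = tensor_class smul C (p + q)"
proof -
  have "tensor_class smul C (p' + q') = tensor_class smul C (p + q)"
    if "p' \<in> tensor_class smul C p" "q' \<in> tensor_class smul C q" for p' q'
    using that words.subspace_add[OF N_sub, of "p' - p" "q' - q"]
    unfolding tensor_class_eq_iff by (simp add: tensor_class_def algebra_simps)
  then show ?thesis
    unfolding qs_add_def using tensor_class_self by blast
qed

lemma qs_scale_class:
  "qs_scale smul C c (tensor_class smul C p) = tensor_class smul C (word_scale c p)"
proof -
  have "tensor_class smul C (word_scale c p') = tensor_class smul C (word_scale c p)"
    if "p' \<in> tensor_class smul C p" for p'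
    using that words.subspace_scale[OF N_sub, of "p' - p" c]
    unfolding tensor_class_eq_iff
    by (simp add: tensor_class_def words.scale_right_diff_distrib)
  then show ?thesis
    unfolding qs_scale_def using tensor_class_self by blast
qed

lemma qs_mult_class:
  assumes "p \<in> free_words C" "q \<in> free_words C"
  shows "qs_mult smul C (tensor_class smul C p) (tensor_class smul C q)
    = tensor_class smul C (qsh p q)"
proof -
  have "tensor_class smul C (qsh p' q') = tensor_class smul C (qsh p q)"
    if p': "p' - p \<in> N" and q': "q' - q \<in> N" for p' q'
  proof -
    have "q' \<in> free_words C"
      using words.subspace_add[OF subspace_free_words, of "q' - q" C q] q' N_free assms(2) by auto
    then have "qsh (p' - p) q' + qsh (q' - q) p \<in> N"
      using assms(1) p' q' by (intro words.subspace_add[OF N_sub] qsh_null_left)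
    moreover have "qsh (p' - p) q' = qsh p' q' - qsh p q'"
      by (simp add: qsh_def lin_ext_diff)
    moreover have "qsh (q' - q) p = qsh p q' - qsh p q"
      unfolding qsh_commute[of p] by (simp add: qsh_def lin_ext_diff)
    ultimately show ?thesis
      unfolding tensor_class_eq_iff by simp
  qed
  then have "tensor_class smul C (qsh p' q') = tensor_class smul C (qsh p q)"
    if "p' \<in> tensor_class smul C p" "q' \<in> tensor_class smul C q" for p' q'
    using that by (simp add: tensor_class_def)
  then show ?thesis
    unfolding qs_mult_def using tensor_class_self by blast
qed

end

section \<open>Complete lambda-rings over a field of characteristic zero\<close>

text \<open>
  The last assumption says that the canonical map from \<open>A\<close> to the inverse limit of the
  \<open>A / F i\<close> is bijective: a point of the limit is given by representatives \<open>s i\<close> with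
  \<open>s (i + 1) = s i\<close> modulo \<open>F i\<close>. The value \<open>psi 0\<close> is irrelevant.
\<close>

locale complete_lambda_ring = vector_space smul
  for smul :: "'k::field_char_0 \<Rightarrow> 'a::comm_ring_1 \<Rightarrow> 'a" +
  fixes psi :: "nat \<Rightarrow> 'a \<Rightarrow> 'a" and F :: "nat \<Rightarrow> 'a set"
  assumes scale_mult_left: "smul c (x * y) = smul c x * y"
    and psi_add: "n \<ge> 1 \<Longrightarrow> psi n (x + y) = psi n x + psi n y"
    and psi_mult: "n \<ge> 1 \<Longrightarrow> psi n (x * y) = psi n x * psi n y"
    and psi_one: "n \<ge> 1 \<Longrightarrow> psi n 1 = 1"
    and psi_1: "psi 1 x = x"
    and psi_psi: "m \<ge> 1 \<Longrightarrow> n \<ge> 1 \<Longrightarrow> psi m (psi n x) = psi (m * n) x"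
    and psi_const: "n \<ge> 1 \<Longrightarrow> psi n (smul c 1) = smul c 1"
    and F_subspace: "subspace (F i)"
    and F_0: "F 0 = UNIV"
    and F_decreasing: "F (Suc i) \<subseteq> F i"
    and F_mult: "x \<in> F i \<Longrightarrow> y \<in> F j \<Longrightarrow> x * y \<in> F (i + j)"
    and psi_F: "n \<ge> 1 \<Longrightarrow> x \<in> F i \<Longrightarrow> psi n x \<in> F (n * i)"
    and F_complete: "(\<And>i. s (Suc i) - s i \<in> F i) \<Longrightarrow> \<exists>!y. \<forall>i. y - s i \<in> F i"

definition filtration_topology :: "(nat \<Rightarrow> 'a::comm_ring_1 set) \<Rightarrow> 'a topology" where
  "filtration_topology F = topology_generated_by {{y. y - x \<in> F i} |x i. True}"

definition filtration_has_sum ::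
    "(nat \<Rightarrow> 'a::comm_ring_1 set) \<Rightarrow> ('b \<Rightarrow> 'a) \<Rightarrow> 'b set \<Rightarrow> 'a \<Rightarrow> bool" where
  "filtration_has_sum F f S s \<longleftrightarrow>
     limitin (filtration_topology F) (sum f) s (finite_subsets_at_top S)"

section \<open>The map Z and the operators on power series\<close>

definition decreasing_tuples :: "nat \<Rightarrow> nat list set" where
  "decreasing_tuples l = {ns. length ns = l \<and> sorted_wrt (>) ns \<and> (\<forall>n\<in>set ns. n > 0)}"

definition is_Z_map ::
    "('k::field \<Rightarrow> 'a::comm_ring_1 \<Rightarrow> 'a) \<Rightarrow> (nat \<Rightarrow> 'a \<Rightarrow> 'a) \<Rightarrow> (nat \<Rightarrow> 'a set) \<Rightarrow>
      (('a list \<Rightarrow>\<^sub>0 'k) set \<Rightarrow> 'a) \<Rightarrow> bool" where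
  "is_Z_map smul psi F Z \<longleftrightarrow>
     qs_linear smul (F 1) Z \<and> Z (qs_one smul (F 1)) = 1 \<and>
     (\<forall>as. as \<noteq> [] \<longrightarrow> set as \<subseteq> F 1 \<longrightarrow>
        filtration_has_sum F (\<lambda>ns. \<Prod>i<length as. psi (ns ! i) (as ! i))
          (decreasing_tuples (length as)) (Z (pure_tensor smul (F 1) as)))"

text \<open>
  \<open>P_op psi a\<close> is the operator \<open>t^n \<mapsto> psi n a * t^n\<close>, extended linearly and \<open>t\<close>-adically
  continuously, on the power series without constant term. On the other series it carries no
  meaning; it is only applied to values of \<open>T_op\<close>.
\<close>

definition P_op :: "(nat \<Rightarrow> 'a \<Rightarrow> 'a) \<Rightarrow> 'a \<Rightarrow> 'a::comm_ring_1 fps \<Rightarrow> 'a fps" where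
  "P_op psi a f = Abs_fps (\<lambda>n. if n = 0 then 0 else fps_nth f n * psi n a)"

definition T_op :: "'a::comm_ring_1 fps \<Rightarrow> 'a fps" where
  "T_op f = fps_X * fps_right_inverse (1 - fps_X) 1 * f"

lemma P_op_X_power: "n \<ge> 1 \<Longrightarrow> P_op psi a (fps_X ^ n) = fps_const (psi n a) * fps_X ^ n"
  by (rule fps_ext) (simp add: P_op_def fps_X_power_nth)

lemma T_op_fraction: "(1 - fps_X) * T_op f = fps_X * (f :: 'a::comm_ring_1 fps)"
proof -
  have "(1 - fps_X) * fps_right_inverse (1 - fps_X) (1::'a) = 1"
    by (rule fps_right_inverse) simp
  then show ?thesis
    unfolding T_op_def by (metis mult.assoc mult.left_commute mult_1)
qed

definition eval_at_one :: "(nat \<Rightarrow> 'a::comm_ring_1 set) \<Rightarrow> 'a fps \<Rightarrow> 'a \<Rightarrow> bool" where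
  "eval_at_one F f z \<longleftrightarrow> filtration_has_sum F (fps_nth f) UNIV z"

end

(* The partial sums z_N of Z over N >= n_1 > ... > n_l satisfy
   z_{N+1}(a u) = z_N(a u) + psi^{N+1}(a) z_N(u).  Multiplying out two such recursions reproduces
   the three terms of the quasi-shuffle recursion, because psi^{N+1} is multiplicative; hence every
   z_N is multiplicative by induction on N.  Moreover z_N(w) is the sum of the coefficients up to N
   of the series obtained from the operators P and T, and Z(w) - z_N(w) lies in F^N.  Since the
   intersection of the filtration is zero, all identities pass to the limit. *)

theory Submission
  imports Defs
begin

section \<open>Coefficients of \<open>T_op\<close> and expansion of a combination into words\<close>

text \<open>Comparing coefficients in \<open>T_op_fraction\<close> shows that consecutive
  coefficients of \<open>T_op f\<close> differ by one coefficient of \<open>f\<close>. The bound is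
  strict because of the factor t in t/(1-t); it becomes the strict inequality between consecutive
  n_i.\<close>

lemma fps_nth_T_op: "fps_nth (T_op f) n = (\<Sum>m<n. fps_nth f m)"
proof (induction n)
  case 0
  show ?case
    using arg_cong[OF T_op_fraction[of f], of "\<lambda>g. fps_nth g 0"]
    by (simp add: left_diff_distrib)
next
  case (Suc n)
  have "fps_nth (T_op f) (Suc n) - fps_nth (T_op f) n = fps_nth f n"
    using arg_cong[OF T_op_fraction[of f], of "\<lambda>g. fps_nth g (Suc n)"]
    by (simp add: left_diff_distrib)
  then show ?case
    using Suc.IH by (simp add: algebra_simps)
qed

lemma poly_mapping_eq_sum_word_scale:
  "p = (\<Sum>w\<in>Poly_Mapping.keys p. word_scale (Poly_Mapping.lookup p w) (Poly_Mapping.single w 1))"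
proof -
  have "lin_ext (\<lambda>w. Poly_Mapping.single w 1) p = p"
    by (rule poly_mapping_eqI)
       (auto simp: lin_ext_def lookup_sum lookup_single when_def in_keys_iff sum.delta' sum.delta
          if_distrib[of "\<lambda>x. _ * x"] cong: if_cong)
  then show ?thesis
    by (simp add: lin_ext_def)
qed

lemma qsh_words_Nil_right: "qsh_words u [] = Poly_Mapping.single u 1"
  by (cases u) auto

section \<open>Strictly decreasing tuples with bounded entries\<close>

definition bounded_tuples :: "nat \<Rightarrow> nat \<Rightarrow> nat list set" where
  "bounded_tuples N l = {ns \<in> decreasing_tuples l. set ns \<subseteq> {..N}}"

lemma finite_bounded_tuples: "finite (bounded_tuples N l)"
  by (rule finite_subset[OF _ finite_lists_length_eq[of "{..N}" l]])
     (auto simp: bounded_tuples_def decreasing_tuples_def)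

lemma bounded_tuples_0_right: "bounded_tuples N 0 = {[]}"
  by (auto simp: bounded_tuples_def decreasing_tuples_def)

lemma bounded_tuples_0_Suc: "bounded_tuples 0 (Suc l) = {}"
  by (force simp: bounded_tuples_def decreasing_tuples_def length_Suc_conv)

text \<open>A strictly decreasing tuple with entries up to N+1 can contain N+1 only as its head; the
  two pieces are the tuples without it and with it.\<close>

lemma bounded_tuples_Suc_Suc:
  "bounded_tuples (Suc N) (Suc l) = bounded_tuples N (Suc l) \<union> Cons (Suc N) ` bounded_tuples N l"
proof (intro set_eqI iffI)
  fix ns assume "ns \<in> bounded_tuples (Suc N) (Suc l)"
  then show "ns \<in> bounded_tuples N (Suc l) \<union> Cons (Suc N) ` bounded_tuples N l"
    by (cases ns; cases "hd ns = Suc N")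
       (fastforce simp: bounded_tuples_def decreasing_tuples_def)+
next
  fix ns assume "ns \<in> bounded_tuples N (Suc l) \<union> Cons (Suc N) ` bounded_tuples N l"
  then show "ns \<in> bounded_tuples (Suc N) (Suc l)"
    by (fastforce simp: bounded_tuples_def decreasing_tuples_def)
qed

context complete_lambda_ring
begin

subsection \<open>Sums in the filtration topology\<close>

lemma F_mono: "i \<le> j \<Longrightarrow> F j \<subseteq> F i"
  by (rule lift_Suc_antimono_le[of F, OF F_decreasing])

lemma F_ideal: "x \<in> F i \<Longrightarrow> x * y \<in> F i"
  using F_mult[of x i y 0] by (simp add: F_0)

lemma F_ideal': "y \<in> F i \<Longrightarrow> x * y \<in> F i"
  using F_ideal[of y i x] by (simp add: mult.commute)

text \<open>By completeness the zero sequence has only one limit, and both 0 and \<open>x\<close>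
  are limits of it.\<close>

lemma F_separated:
  assumes "\<And>i. x \<in> F i"
  shows "x = 0"
proof -
  have "\<exists>!y. \<forall>i. y - 0 \<in> F i"
    by (rule F_complete) (simp add: subspace_0[OF F_subspace])
  then show ?thesis
    using assms subspace_0[OF F_subspace] by (metis diff_zero)
qed

lemma openin_coset: "openin (filtration_topology F) {y. y - x \<in> F i}"
  unfolding filtration_topology_def by (rule topology_generated_by_Basis) blast

text \<open>The cosets enter the topology only as a subbasis. That they suffice as neighbourhoods
  follows since the filtration is decreasing, which handles finite intersections, and since every
  point of a coset serves as its centre.\<close>

lemma coset_subset_openin:
  assumes "openin (filtration_topology F) U" "s \<in> U"
  shows "\<exists>i. \<forall>y. y - s \<in> F i \<longrightarrow> y \<in> U"
proof -
  have "generate_topology_on {{y. y - x \<in> F i} |x i. True} U"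
    using assms(1) by (simp add: filtration_topology_def openin_topology_generated_by_iff)
  then show ?thesis
    using assms(2)
  proof induction
    case (Int a b)
    then obtain i j where "\<forall>y. y - s \<in> F i \<longrightarrow> y \<in> a" "\<forall>y. y - s \<in> F j \<longrightarrow> y \<in> b"
      by blast
    then show ?case
      using F_mono[of i "max i j"] F_mono[of j "max i j"]
      by (intro exI[of _ "max i j"]) auto
  next
    case (Basis U)
    then obtain x i where U: "U = {y. y - x \<in> F i}" by blast
    have "y - x \<in> F i" if "y - s \<in> F i" for y
      using subspace_add[OF F_subspace that, of "s - x"] Basis(2) U by simp
    then show ?case using U by blast
  qed blast+
qed

lemma limitin_filtration_topology:
  "limitin (filtration_topology F) g s net \<longleftrightarrow> (\<forall>i. eventually (\<lambda>x. g x - s \<in> F i) net)"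
proof
  assume L: "limitin (filtration_topology F) g s net"
  show "\<forall>i. eventually (\<lambda>x. g x - s \<in> F i) net"
  proof
    fix i
    have "s \<in> {y. y - s \<in> F i}" by (simp add: subspace_0[OF F_subspace])
    with L openin_coset[of s i] show "eventually (\<lambda>x. g x - s \<in> F i) net"
      unfolding limitin_def by fastforce
  qed
next
  assume R: "\<forall>i. eventually (\<lambda>x. g x - s \<in> F i) net"
  have "s \<in> topspace (filtration_topology F)"
    using openin_subset[OF openin_coset[of 0 0]] by (auto simp: F_0)
  moreover have "eventually (\<lambda>x. g x \<in> U) net"
    if U: "openin (filtration_topology F) U" "s \<in> U" for U
  proof -
    obtain i where "\<forall>y. y - s \<in> F i \<longrightarrow> y \<in> U"
      using coset_subset_openin[OF U] by blast
    with R[rule_format, of i] show ?thesis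
      by (simp add: eventually_mono)
  qed
  ultimately show "limitin (filtration_topology F) g s net"
    by (simp add: limitin_def)
qed

text \<open>A finite set containing \<open>B i\<close> adds only terms from the subspace
  \<open>F i\<close>, so one sequence of finite partial sums controls the net of all finite
  subsets.\<close>

lemma filtration_has_sumI:
  assumes "\<And>N. finite (B N)" "\<And>N. B N \<subseteq> S"
    and "\<And>N x. x \<in> S \<Longrightarrow> x \<notin> B N \<Longrightarrow> f x \<in> F N"
    and "\<And>N. s - sum f (B N) \<in> F N"
  shows "filtration_has_sum F f S s"
  unfolding filtration_has_sum_def limitin_filtration_topology
proof
  fix i
  have "sum f Y - s \<in> F i" if Y: "finite Y" "B i \<subseteq> Y" "Y \<subseteq> S" for Y
  proof -
    have "sum f (Y - B i) \<in> F i"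
      using Y assms(3) by (intro subspace_sum[OF F_subspace]) auto
    then have "sum f (Y - B i) - (s - sum f (B i)) \<in> F i"
      using assms(4) by (rule subspace_diff[OF F_subspace])
    then show ?thesis
      using Y by (simp add: sum_diff)
  qed
  then show "eventually (\<lambda>Y. sum f Y - s \<in> F i) (finite_subsets_at_top S)"
    unfolding eventually_finite_subsets_at_top
    using assms(1,2) by (intro exI[of _ "B i"]) simp
qed

text \<open>The net of finite subsets is nontrivial, so some finite partial sum is congruent to both
  limits modulo \<open>F i\<close>; separatedness then identifies them.\<close>

lemma filtration_has_sum_unique:
  assumes "filtration_has_sum F f S s" "filtration_has_sum F f S s'"
  shows "s = s'"
proof -
  have "s - s' \<in> F i" for i
  proof -
    have "eventually (\<lambda>Y. sum f Y - s \<in> F i \<and> sum f Y - s' \<in> F i) (finite_subsets_at_top S)"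
      using assms unfolding filtration_has_sum_def limitin_filtration_topology
      by (simp add: eventually_conj)
    then obtain Y where "sum f Y - s \<in> F i" "sum f Y - s' \<in> F i"
      using eventually_happens'[OF finite_subsets_at_top_neq_bot] by blast
    then show ?thesis
      using subspace_diff[OF F_subspace, of "sum f Y - s'" i "sum f Y - s"] by simp
  qed
  then show ?thesis
    using F_separated[of "s - s'"] by simp
qed

subsection \<open>Linear extension to words\<close>

definition word_eval :: "('b list \<Rightarrow> 'a) \<Rightarrow> ('b list \<Rightarrow>\<^sub>0 'k) \<Rightarrow> 'a" where
  "word_eval f p = (\<Sum>w\<in>Poly_Mapping.keys p. smul (Poly_Mapping.lookup p w) (f w))"

lemma word_eval_superset:
  assumes "finite S" "Poly_Mapping.keys p \<subseteq> S"
  shows "word_eval f p = (\<Sum>w\<in>S. smul (Poly_Mapping.lookup p w) (f w))"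
  unfolding word_eval_def using assms
  by (intro sum.mono_neutral_left) (auto simp: in_keys_iff)

lemma word_eval_add: "word_eval f (p + q) = word_eval f p + word_eval f q"
proof -
  let ?S = "Poly_Mapping.keys p \<union> Poly_Mapping.keys q"
  have "word_eval f (p + q) = (\<Sum>w\<in>?S. smul (Poly_Mapping.lookup (p + q) w) (f w))"
    by (intro word_eval_superset Poly_Mapping.keys_add) auto
  also have "\<dots> = word_eval f p + word_eval f q"
    by (subst (1 2) word_eval_superset[of ?S])
       (auto simp: lookup_add scale_left_distrib sum.distrib)
  finally show ?thesis .
qed

lemma word_eval_scale: "word_eval f (word_scale c p) = smul c (word_eval f p)"
  by (subst (1 2) word_eval_superset[of "Poly_Mapping.keys p"])
     (auto simp: in_keys_iff scale_sum_right)

lemma word_eval_zero [simp]: "word_eval f 0 = 0"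
  by (simp add: word_eval_def)

lemma word_eval_single [simp]: "word_eval f (Poly_Mapping.single w c) = smul c (f w)"
  by (subst word_eval_superset[of "{w}"]) auto

lemma word_eval_diff: "word_eval f (p - q) = word_eval f p - word_eval f q"
  by (metis add_diff_cancel_right' diff_add_cancel word_eval_add)

lemma word_eval_sum: "word_eval f (sum g S) = (\<Sum>x\<in>S. word_eval f (g x))"
  by (induction S rule: infinite_finite_induct) (auto simp: word_eval_add)

lemma word_eval_lin_ext: "word_eval f (lin_ext g p) = word_eval (\<lambda>w. word_eval f (g w)) p"
  by (simp add: lin_ext_def word_eval_sum word_eval_scale) (simp add: word_eval_def)

lemma word_eval_prepend: "word_eval f (prepend a p) = word_eval (\<lambda>w. f (a # w)) p"
  by (simp add: prepend_def word_eval_lin_ext)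

lemma scale_mult_right: "smul c (x * y) = x * smul c y"
  by (metis mult.commute scale_mult_left)

lemma word_eval_mult_left: "word_eval (\<lambda>w. x * f w) p = x * word_eval f p"
  by (simp add: word_eval_def sum_distrib_left scale_mult_right)

lemma word_eval_mult_right: "word_eval (\<lambda>w. f w * x) p = word_eval f p * x"
  using word_eval_mult_left[of x f p] by (simp add: mult.commute)

lemma word_eval_fun_add: "word_eval (\<lambda>w. f w + g w) p = word_eval f p + word_eval g p"
  by (simp add: word_eval_def scale_right_distrib sum.distrib)

lemma word_eval_fun_diff: "word_eval (\<lambda>w. f w - g w) p = word_eval f p - word_eval g p"
  by (simp add: word_eval_def scale_right_diff_distrib sum_subtractf)

lemma word_eval_mem_F:
  assumes "\<And>w. set w \<subseteq> C \<Longrightarrow> f w \<in> F i" "p \<in> free_words C"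
  shows "word_eval f p \<in> F i"
  unfolding word_eval_def using assms
  by (intro subspace_sum[OF F_subspace] subspace_scale[OF F_subspace]) (auto simp: free_words_def)

lemma word_eval_cong:
  assumes "\<And>w. set w \<subseteq> C \<Longrightarrow> f w = g w" "p \<in> free_words C"
  shows "word_eval f p = word_eval g p"
  unfolding word_eval_def using assms by (intro sum.cong) (auto simp: free_words_def)

subsection \<open>Truncated sums\<close>

text \<open>The partial sum over N >= n_1 > ... > n_l > 0, split by whether n_1 takes the largest
  admissible value; \<open>truncated_zeta_eq_sum_tuples\<close> gives the explicit sum. The
  recursive form matches both the quasi-shuffle recursion and the operators.\<close>

fun truncated_zeta :: "nat \<Rightarrow> 'a list \<Rightarrow> 'a" where
  "truncated_zeta N [] = 1"
| "truncated_zeta 0 (a # u) = 0"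
| "truncated_zeta (Suc N) (a # u) = truncated_zeta N (a # u) + psi (Suc N) a * truncated_zeta N u"

text \<open>The induction is on N, not on the lengths of the words: with \<open>u\<close> and
  \<open>v\<close> arbitrary, the hypothesis applies to the four pairs formed from the words and
  their tails, and these give the four terms of the expanded product.\<close>

lemma truncated_zeta_qsh_words:
  "word_eval (truncated_zeta N) (qsh_words u v) = truncated_zeta N u * truncated_zeta N v"
proof (induction N arbitrary: u v)
  case 0
  show ?case
    by (cases u; cases v) (simp_all add: word_eval_add word_eval_prepend, simp add: word_eval_def)
next
  case (Suc N)
  show ?case
  proof (cases "u = [] \<or> v = []")
    case True
    then show ?thesis
      by (auto simp: qsh_words_Nil_right)
  next
    case False
    then obtain a u' b v' where uv: "u = a # u'" "v = b # v'"
      by (meson neq_Nil_conv)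
    let ?z = "truncated_zeta N"
    \<comment> \<open>The recursion in N, extended linearly to combinations of words that all begin
      with \<open>x\<close>.\<close>
    have pre: "word_eval (truncated_zeta (Suc N)) (prepend x p)
        = word_eval ?z (prepend x p) + psi (Suc N) x * word_eval ?z p" for x p
      by (simp add: word_eval_prepend word_eval_fun_add word_eval_mult_left)
    have "word_eval (truncated_zeta (Suc N)) (qsh_words u v)
        = word_eval ?z (qsh_words u v) + psi (Suc N) a * word_eval ?z (qsh_words u' v)
          + psi (Suc N) b * word_eval ?z (qsh_words u v')
          + psi (Suc N) (a * b) * word_eval ?z (qsh_words u' v')"
      by (simp add: uv word_eval_add pre)
    also have "\<dots> = (?z u + psi (Suc N) a * ?z u') * (?z v + psi (Suc N) b * ?z v')"
      by (simp add: Suc.IH psi_mult algebra_simps)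
    finally show ?thesis
      by (simp add: uv)
  qed
qed

text \<open>Scaling by c is multiplication by the element \<open>smul c 1\<close>, which
  \<open>psi n\<close> fixes.\<close>

lemma psi_smul: "n \<ge> 1 \<Longrightarrow> psi n (smul c x) = smul c (psi n x)"
  using psi_mult[of n "smul c 1" x] by (simp add: psi_const flip: scale_mult_left)

text \<open>Together with \<open>truncated_zeta_append_smul\<close> this is multilinearity in the
  letters, which survives the limit and lets Z descend to the tensor powers.\<close>

lemma truncated_zeta_append_add:
  "truncated_zeta N (u @ (a + b) # v) = truncated_zeta N (u @ a # v) + truncated_zeta N (u @ b # v)"
proof (induction N arbitrary: u)
  case 0
  show ?case by (cases u) auto
next
  case (Suc N)
  show ?case
  proof (cases u)
    case Nil
    then show ?thesis
      using Suc.IH[of "[]"] by (simp add: psi_add algebra_simps)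
  next
    case (Cons x u')
    then show ?thesis
      using Suc.IH[of u] Suc.IH[of u'] by (simp add: algebra_simps)
  qed
qed

lemma truncated_zeta_append_smul:
  "truncated_zeta N (u @ smul c a # v) = smul c (truncated_zeta N (u @ a # v))"
proof (induction N arbitrary: u)
  case 0
  show ?case by (cases u) auto
next
  case (Suc N)
  show ?case
  proof (cases u)
    case Nil
    then show ?thesis
      using Suc.IH[of "[]"] by (simp add: psi_smul scale_right_distrib flip: scale_mult_left)
  next
    case (Cons x u')
    then show ?thesis
      using Suc.IH[of u] Suc.IH[of u'] by (simp add: scale_right_distrib flip: scale_mult_right)
  qed
qed

lemma truncated_zeta_eq_sum_tuples:
  "truncated_zeta N as
    = (\<Sum>ns\<in>bounded_tuples N (length as). \<Prod>i<length as. psi (ns ! i) (as ! i))"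
proof (induction N as rule: truncated_zeta.induct)
  case (3 N a u)
  let ?g = "\<lambda>ns. \<Prod>i<length (a # u). psi (ns ! i) ((a # u) ! i)"
  have disj: "bounded_tuples N (Suc (length u)) \<inter> Cons (Suc N) ` bounded_tuples N (length u) = {}"
    by (auto simp: bounded_tuples_def)
  have "sum ?g (Cons (Suc N) ` bounded_tuples N (length u))
      = (\<Sum>ns\<in>bounded_tuples N (length u). psi (Suc N) a * (\<Prod>i<length u. psi (ns ! i) (u ! i)))"
    by (subst sum.reindex) (auto simp: prod.lessThan_Suc_shift simp del: prod.lessThan_Suc)
  also have "\<dots> = psi (Suc N) a * truncated_zeta N u"
    by (simp add: 3 sum_distrib_left)
  finally show ?case
    using 3 disj
    by (simp add: bounded_tuples_Suc_Suc sum.union_disjoint finite_bounded_tuples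
        del: prod.lessThan_Suc)
qed (auto simp: bounded_tuples_0_right bounded_tuples_0_Suc)

text \<open>Coefficient N+1 of P_a T f is psi^{N+1}(a) times the sum of the coefficients of f up to
  N, which is the increment in the recursion of \<open>truncated_zeta\<close>.\<close>

lemma truncated_zeta_eq_sum_fps_nth:
  "truncated_zeta N as = (\<Sum>m\<le>N. fps_nth (foldr (\<lambda>a f. P_op psi a (T_op f)) as 1) m)"
proof (induction N as rule: truncated_zeta.induct)
  case (1 N)
  show ?case by (simp add: sum.delta if_distrib)
next
  case (2 a u)
  show ?case by (simp add: P_op_def)
next
  case (3 N a u)
  then show ?case
    by (simp add: P_op_def fps_nth_T_op lessThan_Suc_atMost mult.commute)
qed

subsection \<open>The limit\<close>

text \<open>For a nonempty word the increment has the factor psi^{N+1}(a), where a is the first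
  letter, and psi^{N+1} carries F^1 into F^{N+1}.\<close>

lemma truncated_zeta_step:
  assumes "set as \<subseteq> F 1"
  shows "truncated_zeta (Suc N) as - truncated_zeta N as \<in> F (Suc N)"
  using assms psi_F[of "Suc N" _ 1]
  by (cases as) (auto intro!: F_ideal simp: subspace_0[OF F_subspace])

text \<open>The future value of Z on a pure tensor. For letters in \<open>F 1\<close> the
  description is uniquely satisfied, by \<open>F_complete\<close>.\<close>

definition zeta :: "'a list \<Rightarrow> 'a" where
  "zeta as = (THE y. \<forall>i. y - truncated_zeta i as \<in> F i)"

lemma zeta_approx:
  assumes "set as \<subseteq> F 1"
  shows "zeta as - truncated_zeta N as \<in> F N"
proof -
  have "\<exists>!y. \<forall>i. y - truncated_zeta i as \<in> F i"
    using truncated_zeta_step[OF assms] F_decreasing by (intro F_complete) blast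
  from theI'[OF this] show ?thesis
    by (simp add: zeta_def)
qed

lemma zeta_unique:
  assumes "set as \<subseteq> F 1" "\<And>i. y - truncated_zeta i as \<in> F i"
  shows "y = zeta as"
proof -
  have "y - zeta as \<in> F i" for i
    using subspace_diff[OF F_subspace assms(2) zeta_approx[OF assms(1)]] by simp
  then show ?thesis
    using F_separated[of "y - zeta as"] by simp
qed

lemma zeta_Nil: "zeta [] = 1"
  by (rule zeta_unique[symmetric]) (auto simp: subspace_0[OF F_subspace])

lemma zeta_append_add:
  assumes "set u \<subseteq> F 1" "a \<in> F 1" "b \<in> F 1" "set v \<subseteq> F 1"
  shows "zeta (u @ (a + b) # v) = zeta (u @ a # v) + zeta (u @ b # v)"
proof (rule zeta_unique[symmetric])
  fix i
  have "(zeta (u @ a # v) - truncated_zeta i (u @ a # v))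
      + (zeta (u @ b # v) - truncated_zeta i (u @ b # v)) \<in> F i"
    using assms by (intro subspace_add[OF F_subspace] zeta_approx) auto
  then show "zeta (u @ a # v) + zeta (u @ b # v) - truncated_zeta i (u @ (a + b) # v) \<in> F i"
    by (simp add: truncated_zeta_append_add algebra_simps)
qed (use assms subspace_add[OF F_subspace] in auto)

lemma zeta_append_smul:
  assumes "set u \<subseteq> F 1" "a \<in> F 1" "set v \<subseteq> F 1"
  shows "zeta (u @ smul c a # v) = smul c (zeta (u @ a # v))"
proof (rule zeta_unique[symmetric])
  fix i
  have "smul c (zeta (u @ a # v) - truncated_zeta i (u @ a # v)) \<in> F i"
    using assms by (intro subspace_scale[OF F_subspace] zeta_approx) auto
  then show "smul c (zeta (u @ a # v)) - truncated_zeta i (u @ smul c a # v) \<in> F i"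
    by (simp add: truncated_zeta_append_smul scale_right_diff_distrib)
qed (use assms subspace_scale[OF F_subspace] in auto)

text \<open>Multilinearity kills the generating relations, so the linear extension of
  \<open>zeta\<close> depends only on the coset.\<close>

lemma zeta_null:
  assumes "p \<in> tensor_null smul (F 1)"
  shows "word_eval zeta p = 0"
  using assms unfolding tensor_null_def
proof (induction rule: words.span_induct_alt)
  case base
  show ?case by simp
next
  case (step c x y)
  have "word_eval zeta x = 0"
    using step(1) unfolding multilinearity_relations_def
    by (auto simp: word_eval_diff zeta_append_add zeta_append_smul)
  then show ?case
    using step by (simp add: word_eval_add word_eval_scale)
qed

lemma F_1_mult_closed: "a \<in> F 1 \<Longrightarrow> b \<in> F 1 \<Longrightarrow> a * b \<in> F 1"
  by (rule F_ideal)

text \<open>Each side is congruent to its truncation modulo every \<open>F i\<close>, and the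
  truncations agree. As \<open>F 1\<close> is closed under products, the words in
  \<open>qsh_words u v\<close> have letters in \<open>F 1\<close>, so the approximation applies to
  them too.\<close>

lemma zeta_qsh_words:
  assumes "set u \<subseteq> F 1" "set v \<subseteq> F 1"
  shows "word_eval zeta (qsh_words u v) = zeta u * zeta v"
proof -
  have "word_eval zeta (qsh_words u v) - zeta u * zeta v \<in> F i" for i
  proof -
    have 1: "word_eval zeta (qsh_words u v) - truncated_zeta i u * truncated_zeta i v \<in> F i"
      unfolding truncated_zeta_qsh_words[symmetric] word_eval_fun_diff[symmetric]
      using assms by (intro word_eval_mem_F[of "F 1"] zeta_approx qsh_words_free F_1_mult_closed)
    \<comment> \<open>This is x y - x' y' written as (x - x') y + x' (y - y'), where each summand
      lies in the ideal \<open>F i\<close>.\<close>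
    have "(zeta u - truncated_zeta i u) * zeta v + truncated_zeta i u * (zeta v - truncated_zeta i v) \<in> F i"
      using assms by (intro subspace_add[OF F_subspace] F_ideal F_ideal' zeta_approx)
    from subspace_diff[OF F_subspace 1 this] show ?thesis
      by (simp add: algebra_simps)
  qed
  then show ?thesis
    using F_separated[of "word_eval zeta (qsh_words u v) - zeta u * zeta v"] by simp
qed

lemma zeta_qsh:
  assumes "p \<in> free_words (F 1)" "q \<in> free_words (F 1)"
  shows "word_eval zeta (qsh p q) = word_eval zeta p * word_eval zeta q"
proof -
  have "word_eval zeta (qsh p q) = word_eval (\<lambda>u. zeta u * word_eval zeta q) p"
    unfolding qsh_def word_eval_lin_ext
    using assms
    by (intro word_eval_cong[of "F 1"])
       (auto simp: zeta_qsh_words word_eval_mult_left[symmetric] simp del: One_nat_def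
          intro!: word_eval_cong[of "F 1"])
  then show ?thesis
    by (simp add: word_eval_mult_right)
qed

lemma zeta_has_sum:
  assumes "set as \<subseteq> F 1"
  shows "filtration_has_sum F (\<lambda>ns. \<Prod>i<length as. psi (ns ! i) (as ! i))
    (decreasing_tuples (length as)) (zeta as)"
proof (rule filtration_has_sumI[where B = "\<lambda>N. bounded_tuples N (length as)"])
  fix N ns
  assume ns: "ns \<in> decreasing_tuples (length as)" "ns \<notin> bounded_tuples N (length as)"
  \<comment> \<open>An entry n_i > N puts the factor psi^{n_i}(a_i) into F^{n_i}, hence into F^N;
    since F^N is an ideal, the whole product follows.\<close>
  then obtain n where "n \<in> set ns" "n > N"
    by (auto simp: bounded_tuples_def) (meson not_le)
  then obtain i where i: "i < length as" "ns ! i > N"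
    using ns by (auto simp: decreasing_tuples_def in_set_conv_nth)
  have "psi (ns ! i) (as ! i) \<in> F (ns ! i * 1)"
    using i assms by (intro psi_F) auto
  then have "psi (ns ! i) (as ! i) \<in> F N"
    using F_mono[of N "ns ! i"] i by auto
  then show "(\<Prod>i<length as. psi (ns ! i) (as ! i)) \<in> F N"
    using i by (subst prod.remove[of _ i]) (auto intro: F_ideal)
qed (use zeta_approx[OF assms] in \<open>auto simp: finite_bounded_tuples truncated_zeta_eq_sum_tuples\<close>,
  auto simp: bounded_tuples_def)

lemma zeta_eval_at_one:
  assumes "set as \<subseteq> F 1"
  shows "eval_at_one F (foldr (\<lambda>a f. P_op psi a (T_op f)) as 1) (zeta as)"
  unfolding eval_at_one_def
proof (rule filtration_has_sumI[where B = "\<lambda>N. {..N}"])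
  fix N n :: nat
  assume "n \<notin> {..N}"
  \<comment> \<open>Since n > N, n is positive, and coefficient n is the increment of the truncated
    sums from m to m+1.\<close>
  then obtain m where m: "n = Suc m" "N \<le> n"
    by (cases n) auto
  have "fps_nth (foldr (\<lambda>a f. P_op psi a (T_op f)) as 1) n \<in> F n"
    using truncated_zeta_step[OF assms, of m] m by (simp add: truncated_zeta_eq_sum_fps_nth)
  then show "fps_nth (foldr (\<lambda>a f. P_op psi a (T_op f)) as 1) n \<in> F N"
    using F_mono m by blast
qed (use zeta_approx[OF assms] in \<open>auto simp: truncated_zeta_eq_sum_fps_nth\<close>)

subsection \<open>The map on the quasi-shuffle algebra\<close>

lemmas F_1_subalgebra = vector_space_axioms scale_mult_left F_subspace[of 1] F_1_mult_closed

lemmas qs_add_class_F_1 = qs_add_class[OF F_1_subalgebra]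
  and qs_scale_class_F_1 = qs_scale_class[OF F_1_subalgebra]
  and qs_mult_class_F_1 = qs_mult_class[OF F_1_subalgebra]

text \<open>The choice of representative is harmless by \<open>zeta_null\<close>;
  \<open>restrict\<close> fixes the values off \<open>QS\<close>, which makes uniqueness as a
  function possible.\<close>

definition zeta_map :: "('a list \<Rightarrow>\<^sub>0 'k) set \<Rightarrow> 'a" where
  "zeta_map = restrict (\<lambda>X. word_eval zeta (SOME p. p \<in> X)) (QS smul (F 1))"

lemma zeta_map_class:
  assumes "p \<in> free_words (F 1)"
  shows "zeta_map (tensor_class smul (F 1) p) = word_eval zeta p"
proof -
  define q where "q = (SOME q. q \<in> tensor_class smul (F 1) p)"
  have "p \<in> tensor_class smul (F 1) p"
    by (simp add: tensor_class_def tensor_null_def words.span_zero)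
  then have "q \<in> tensor_class smul (F 1) p"
    unfolding q_def by (rule someI)
  then have "word_eval zeta (q - p) = 0"
    by (intro zeta_null) (simp add: tensor_class_def)
  then have "word_eval zeta q = word_eval zeta p"
    by (simp add: word_eval_diff)
  then show ?thesis
    using assms by (simp add: zeta_map_def QS_def del: One_nat_def flip: q_def)
qed

lemma is_Z_map_zeta_map: "is_Z_map smul psi F zeta_map"
proof -
  have "qs_linear smul (F 1) zeta_map"
    unfolding qs_linear_def QS_def
    by (auto simp: qs_add_class_F_1 qs_scale_class_F_1 zeta_map_class word_eval_add word_eval_scale
        words.subspace_add[OF subspace_free_words] words.subspace_scale[OF subspace_free_words]
        simp del: One_nat_def)
  then show ?thesis
    using zeta_has_sum
    by (simp add: is_Z_map_def qs_one_def pure_tensor_def zeta_map_class single_in_free_words zeta_Nil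
        del: One_nat_def)
qed

section \<open>Uniqueness and multiplicativity of Z\<close>

text \<open>Linearity reduces the value to pure tensors. There it is prescribed as a limit, or as 1
  on the empty word, and limits are unique. Claims about an arbitrary \<open>Z\<close> thus become
  claims about \<open>zeta\<close>.\<close>

lemma is_Z_map_class:
  assumes Z: "is_Z_map smul psi F Z" and p: "p \<in> free_words (F 1)"
  shows "Z (tensor_class smul (F 1) p) = word_eval zeta p"
proof -
  let ?cl = "tensor_class smul (F 1)"
  have QS: "?cl p \<in> QS smul (F 1)" if "p \<in> free_words (F 1)" for p
    using that by (auto simp: QS_def)
  have add: "Z (?cl (p + q)) = Z (?cl p) + Z (?cl q)"
    if "p \<in> free_words (F 1)" "q \<in> free_words (F 1)" for p q
    using Z QS[OF that(1)] QS[OF that(2)]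
    by (simp add: is_Z_map_def qs_linear_def del: One_nat_def flip: qs_add_class_F_1)
  have scale: "Z (?cl (word_scale c p)) = smul c (Z (?cl p))" if "p \<in> free_words (F 1)" for c p
    using Z QS[OF that]
    by (simp add: is_Z_map_def qs_linear_def del: One_nat_def flip: qs_scale_class_F_1)
  have single: "Z (?cl (Poly_Mapping.single w 1)) = zeta w" if "set w \<subseteq> F 1" for w
  proof (cases "w = []")
    case True
    then show ?thesis
      using Z by (simp add: is_Z_map_def qs_one_def pure_tensor_def zeta_Nil)
  next
    case False
    then show ?thesis
      using Z that filtration_has_sum_unique[OF _ zeta_has_sum[OF that]]
      by (simp add: is_Z_map_def pure_tensor_def)
  qed
  \<comment> \<open>Stated for an arbitrary finite set of words so that induction applies; it is
    then used with the support and coefficients of \<open>p\<close>.\<close>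
  have "Z (?cl (\<Sum>w\<in>S. word_scale (c w) (Poly_Mapping.single w 1))) = (\<Sum>w\<in>S. smul (c w) (zeta w))"
    if "finite S" "\<forall>w\<in>S. set w \<subseteq> F 1" for S c
    using that
  proof (induction S)
    case empty
    have "Z (?cl 0) = 0"
      using scale[of 0 0] by (simp add: free_words_def)
    then show ?case by simp
  next
    case (insert w S)
    have "(\<Sum>w\<in>S. word_scale (c w) (Poly_Mapping.single w 1)) \<in> free_words (F 1)"
      using insert.prems
      by (intro words.subspace_sum[OF subspace_free_words] words.subspace_scale[OF subspace_free_words]
          single_in_free_words) auto
    then show ?case
      using insert by (simp add: add scale single single_in_free_words
          words.subspace_scale[OF subspace_free_words]
          del: word_scale_single One_nat_def)
  qed
  from this[of "Poly_Mapping.keys p" "Poly_Mapping.lookup p"] show ?thesis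
    using p poly_mapping_eq_sum_word_scale[of p] by (simp add: free_words_def word_eval_def)
qed

lemma is_Z_map_unique:
  assumes "is_Z_map smul psi F Z" "Z \<in> extensional (QS smul (F 1))"
  shows "Z = zeta_map"
proof (rule extensionalityI[OF assms(2)])
  show "zeta_map \<in> extensional (QS smul (F 1))"
    by (simp add: zeta_map_def)
  show "Z X = zeta_map X" if "X \<in> QS smul (F 1)" for X
    using that is_Z_map_class[OF assms(1)] by (auto simp: QS_def zeta_map_class simp del: One_nat_def)
qed

lemma is_Z_map_morphism:
  assumes "is_Z_map smul psi F Z"
  shows "qs_algebra_morphism smul (F 1) Z"
proof -
  have *: "qsh p q \<in> free_words (F 1)" if "p \<in> free_words (F 1)" "q \<in> free_words (F 1)" for p q
    unfolding qsh_def using that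
    by (intro lin_ext_mem[OF subspace_free_words, of "F 1"] qsh_words_free F_1_mult_closed)
  have "\<forall>X\<in>QS smul (F 1). \<forall>Y\<in>QS smul (F 1). Z (qs_mult smul (F 1) X Y) = Z X * Z Y"
    unfolding QS_def by (auto simp: * qs_mult_class_F_1 is_Z_map_class[OF assms] zeta_qsh
        simp del: One_nat_def)
  then show ?thesis
    using assms by (simp add: qs_algebra_morphism_def is_Z_map_def)
qed

end

text \<open>Uniqueness is asserted among extensional maps because \<open>is_Z_map\<close> does not
  constrain values outside \<open>QS\<close>.\<close>

theorem theorem2p6:
  fixes smul :: "'k::field_char_0 \<Rightarrow> 'a::comm_ring_1 \<Rightarrow> 'a"
    and psi :: "nat \<Rightarrow> 'a \<Rightarrow> 'a" and F :: "nat \<Rightarrow> 'a set"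
  assumes "complete_lambda_ring smul psi F"
  shows "(\<exists>!Z. Z \<in> extensional (QS smul (F 1)) \<and> is_Z_map smul psi F Z) \<and>
    (\<forall>Z. is_Z_map smul psi F Z \<longrightarrow>
      qs_algebra_morphism smul (F 1) Z \<and>
      (\<forall>as. set as \<subseteq> F 1 \<longrightarrow>
        eval_at_one F (foldr (\<lambda>a f. P_op psi a (T_op f)) as 1)
          (Z (pure_tensor smul (F 1) as))))"
proof -
  interpret complete_lambda_ring smul psi F by (fact assms)
  have "zeta_map \<in> extensional (QS smul (F 1))"
    by (simp add: zeta_map_def)
  then have "\<exists>!Z. Z \<in> extensional (QS smul (F 1)) \<and> is_Z_map smul psi F Z"
    using is_Z_map_zeta_map is_Z_map_unique by blast
  moreover have "eval_at_one F (foldr (\<lambda>a f. P_op psi a (T_op f)) as 1) (Z (pure_tensor smul (F 1) as))"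
    if Z: "is_Z_map smul psi F Z" and as: "set as \<subseteq> F 1" for Z as
    using zeta_eval_at_one[OF as] as
    by (simp add: pure_tensor_def is_Z_map_class[OF Z] single_in_free_words del: One_nat_def)
  ultimately show ?thesis
    using is_Z_map_morphism by blast
qed

end
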